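(* Let $\{x_n,y_n\}_{n=-1}^{\infty}$ be a solution of the system of difference equations $$x_{n+1}=\frac{1}{y_n(x_{n-1}+1)+1},\qquad y_{n+1}=\frac{1}{x_n(y_{n-1}+1)+1},\qquad n=0,1,2,\dots,$$ with real initial conditions satisfying $(x_{-1},y_{-1},x_0,y_0)\in\mathbb{R}^4\setminus F$, where $$F=\bigcup_{n=-1}^{\infty}\left\{(x_{-1},y_{-1},x_0,y_0)\in\mathbb{R}^4: A_n=0\ \text{or}\ B_n=0\ \text{or}\ C_n=0\ \text{or}\ D_n=0\right\}$$ and $$A_n=T_{2n-1}x_{-1}y_0+(T_{2n-2}+T_{2n-1})y_0+T_{2n},$$ $$B_n=T_{2n}y_{-1}x_0+(T_{2n-1}+T_{2n})x_0+T_{2n+1},$$ $$C_n=T_{2n-1}y_{-1}x_0+(T_{2n-2}+T_{2n-1})x_0+T_{2n},$$ $$D_n=T_{2n}x_{-1}y_0+(T_{2n-1}+T_{2n})y_0+T_{2n+1}.$$ Here $T_n$ is the $n$th Tribonacci number. Then, for all $n=0,1,2,\dots$, $$x_{2n-1}=\frac{T_{2n-2}x_{-1}y_0+(T_{2n}-T_{2n-1})y_0+T_{2n-1}}{T_{2n-1}x_{-1}y_0+(T_{2n-2}+T_{2n-1})y_0+T_{2n}},$$ $$x_{2n}=\frac{T_{2n-1}y_{-1}x_0+(T_{2n+1}-T_{2n})x_0+T_{2n}}{T_{2n}y_{-1}x_0+(T_{2n-1}+T_{2n})x_0+T_{2n+1}},$$ $$y_{2n-1}=\frac{T_{2n-2}y_{-1}x_0+(T_{2n}-T_{2n-1})x_0+T_{2n-1}}{T_{2n-1}y_{-1}x_0+(T_{2n-2}+T_{2n-1})x_0+T_{2n}},$$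 $$y_{2n}=\frac{T_{2n-1}x_{-1}y_0+(T_{2n+1}-T_{2n})y_0+T_{2n}}{T_{2n}x_{-1}y_0+(T_{2n-1}+T_{2n})y_0+T_{2n+1}}.$$
   Context: The Tribonacci numbers $(T_n)_{n\in\mathbb{Z}}$ are defined by $T_0=0$, $T_1=1$, $T_2=1$ and $T_{n+3}=T_{n+2}+T_{n+1}+T_n$, extended to negative indices by the same recurrence, i.e. $T_{-n}=T_{-n+3}-T_{-n+2}-T_{-n+1}$ for $n\ge 1$ (so $T_{-1}=0$, $T_{-2}=1$, $T_{-3}=-1$, $T_{-4}=0$). *)

theory Defs
  imports Complex_Main
begin

function trib :: "int \<Rightarrow> int" where
  "trib n =
     (if n = 0 then 0
      else if n = 1 \<or> n = 2 then 1
      else if n > 2 then trib (n - 1) + trib (n - 2) + trib (n - 3)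
      else trib (n + 3) - trib (n + 2) - trib (n + 1))"
  by pat_completeness auto
termination
  by (relation "measure (\<lambda>n. if n < 0 then nat (- n) + 3 else nat n)") auto

declare trib.simps [simp del]

lemma trib_initial: "trib 0 = 0" "trib 1 = 1" "trib 2 = 1"
  by (simp_all add: trib.simps)

lemma trib_recurrence: "trib (n + 3) = trib (n + 2) + trib (n + 1) + trib n"
proof (cases "n \<ge> 0")
  case True
  then show ?thesis
    by (subst trib.simps) (simp add: algebra_simps)
next
  case False
  then show ?thesis
    by (subst (4) trib.simps) simp
qed

lemma trib_negative: "trib (- 1) = 0" "trib (- 2) = 1" "trib (- 3) = - 1" "trib (- 4) = 0"
  by (simp_all add: trib.simps)

abbreviation T :: "int \<Rightarrow> real" where
  "T n \<equiv> real_of_int (trib n)"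

text \<open>In the following, \<open>x'\<close> and \<open>y'\<close> stand for the initial values with index \<open>-1\<close>,
  and \<open>x\<close> and \<open>y\<close> for those with index \<open>0\<close>.\<close>

definition A :: "int \<Rightarrow> real \<Rightarrow> real \<Rightarrow> real \<Rightarrow> real \<Rightarrow> real" where
  "A n x' y' x y = T (2*n - 1) * x' * y + (T (2*n - 2) + T (2*n - 1)) * y + T (2*n)"

definition B :: "int \<Rightarrow> real \<Rightarrow> real \<Rightarrow> real \<Rightarrow> real \<Rightarrow> real" where
  "B n x' y' x y = T (2*n) * y' * x + (T (2*n - 1) + T (2*n)) * x + T (2*n + 1)"

definition C :: "int \<Rightarrow> real \<Rightarrow> real \<Rightarrow> real \<Rightarrow> real \<Rightarrow> real" where
  "C n x' y' x y = T (2*n - 1) * y' * x + (T (2*n - 2) + T (2*n - 1)) * x + T (2*n)"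

definition D :: "int \<Rightarrow> real \<Rightarrow> real \<Rightarrow> real \<Rightarrow> real \<Rightarrow> real" where
  "D n x' y' x y = T (2*n) * x' * y + (T (2*n - 1) + T (2*n)) * y + T (2*n + 1)"

definition F :: "(real \<times> real \<times> real \<times> real) set" where
  "F = (\<Union>n\<in>{-1..}. {(x', y', x, y).
          A n x' y' x y = 0 \<or> B n x' y' x y = 0 \<or> C n x' y' x y = 0 \<or> D n x' y' x y = 0})"

text \<open>The sequences are indexed by \<open>n \<ge> -1\<close>; values at smaller indices are irrelevant.
  Division by zero yields zero, but for initial values outside \<^const>\<open>F\<close> no
  denominator in the system vanishes, so non-vanishing is not imposed separately.\<close>

definition is_solution :: "(int \<Rightarrow> real) \<Rightarrow> (int \<Rightarrow> real) \<Rightarrow> bool" where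
  "is_solution x y \<longleftrightarrow> (\<forall>n\<ge>0.
     x (n + 1) = 1 / (y n * (x (n - 1) + 1) + 1) \<and>
     y (n + 1) = 1 / (x n * (y (n - 1) + 1) + 1))"

end

theory Submission imports Defs begin

text \<open>The system decouples: the sequence alternating between \<open>x\<close> (odd indices) and \<open>y\<close>
  (even indices), and the complementary one, both satisfy the scalar recurrence
  \<open>z (m + 1) = 1 / (z m * (z (m - 1) + 1) + 1)\<close>. The substitution \<open>z m = q (m - 1) / q m\<close>
  turns it into the linear recurrence \<open>q (m + 1) = q m + q (m - 1) + q (m - 2)\<close>, solved by
  Tribonacci numbers. All four denominators of the theorem are values of \<open>q\<close>, and the condition
  on \<open>F\<close> says that \<open>q\<close> has no zero at indices \<open>m \<ge> -3\<close>.\<close>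

text \<open>This is the sequence \<open>q\<close> with seeds \<open>q (-2) = a * b\<close>,
  \<open>q (-1) = b\<close>, \<open>q 0 = 1\<close>, chosen so that its successive quotients start
  with \<open>a\<close> (if \<open>b\<close> is nonzero) and \<open>b\<close>.\<close>

definition trib_comb :: "real \<Rightarrow> real \<Rightarrow> int \<Rightarrow> real" where
  "trib_comb a b m = T m * a * b + (T (m - 1) + T m) * b + T (m + 1)"

lemma T_recurrence: "T (m + 1) = T m + T (m - 1) + T (m - 2)"
proof -
  have "trib (m + 1) = trib m + trib (m - 1) + trib (m - 2)"
    using trib_recurrence [of "m - 2"] by (simp add: algebra_simps)
  then show ?thesis by simp
qed

lemma trib_comb_recurrence:
  "trib_comb a b (m + 1) = trib_comb a b m + trib_comb a b (m - 1) + trib_comb a b (m - 2)"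
proof -
  have "T (m + 2) = T (m + 1) + T m + T (m - 1)"
    using T_recurrence [of "m + 1"] by (simp add: add.commute)
  moreover have "T m = T (m - 1) + T (m - 2) + T (m - 3)"
    using T_recurrence [of "m - 1"] by simp
  ultimately show ?thesis
    using T_recurrence [of m] by (simp add: trib_comb_def algebra_simps)
qed

text \<open>Brings numerators to the shape used in the theorem.\<close>

lemma trib_comb_pred:
  "trib_comb a b (m - 1) = T (m - 1) * a * b + (T (m + 1) - T m) * b + T m"
  using T_recurrence [of m] by (simp add: trib_comb_def algebra_simps)

lemma scalar_solution:
  fixes z :: "int \<Rightarrow> real"
  assumes rec: "\<And>m. m \<ge> 0 \<Longrightarrow> z (m + 1) = 1 / (z m * (z (m - 1) + 1) + 1)"
    and nz: "\<And>m. m \<ge> -1 \<Longrightarrow> trib_comb (z (-1)) (z 0) m \<noteq> 0"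
    and "m \<ge> -1"
  shows "z m = trib_comb (z (-1)) (z 0) (m - 1) / trib_comb (z (-1)) (z 0) m"
proof -
  define q where "q = trib_comb (z (-1)) (z 0)"
  have init: "q (-2) = z (-1) * z 0" "q (-1) = z 0" "q 0 = 1"
    by (simp_all add: q_def trib_comb_def trib_initial trib_negative)
  \<comment> \<open>The recurrence has order two, so the induction carries two consecutive values;
    the first conjunct also covers index \<open>-1\<close>.\<close>
  have "z (m - 1) = q (m - 2) / q (m - 1) \<and> z m = q (m - 1) / q m" if "m \<ge> 0" for m
    using that
  proof (induction m rule: int_ge_induct)
    case base
    \<comment> \<open>Nonvanishing at \<open>-1\<close> means \<open>z 0 \<noteq> 0\<close>, which
      allows cancelling in \<open>z (-1) = z (-1) * z 0 / z 0\<close>.\<close>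
    show ?case using init nz [of "-1"] by (simp add: q_def)
  next
    case (step m)
    have "q (m - 1) \<noteq> 0" "q m \<noteq> 0"
      using step.hyps nz [of "m - 1"] nz [of m] by (simp_all add: q_def)
    then have "z m * (z (m - 1) + 1) + 1 = (q m + q (m - 1) + q (m - 2)) / q m"
      unfolding step.IH [THEN conjunct1] step.IH [THEN conjunct2] by (simp add: field_simps)
    also have "\<dots> = q (m + 1) / q m"
      by (simp add: q_def trib_comb_recurrence)
    finally have "z (m + 1) = q m / q (m + 1)"
      using rec [OF step.hyps] by simp
    then show ?case using step.IH by simp
  qed
  from this [of "m + 1"] show ?thesis
    using \<open>m \<ge> -1\<close> by (simp add: q_def)
qed

text \<open>Only half of the formulas is stated: the system is symmetric under exchanging
  \<open>x\<close> and \<open>y\<close>, which yields the rest.\<close>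

lemma interleaved_solution:
  fixes x y :: "int \<Rightarrow> real"
  assumes x_rec: "\<And>n. n \<ge> 0 \<Longrightarrow> x (n + 1) = 1 / (y n * (x (n - 1) + 1) + 1)"
    and y_rec: "\<And>n. n \<ge> 0 \<Longrightarrow> y (n + 1) = 1 / (x n * (y (n - 1) + 1) + 1)"
    and nz: "\<And>m. m \<ge> -1 \<Longrightarrow> trib_comb (x (-1)) (y 0) m \<noteq> 0"
    and "n \<ge> 0"
  shows "x (2*n - 1) = trib_comb (x (-1)) (y 0) (2*n - 1 - 1) / trib_comb (x (-1)) (y 0) (2*n - 1)"
    and "y (2*n) = trib_comb (x (-1)) (y 0) (2*n - 1) / trib_comb (x (-1)) (y 0) (2*n)"
proof -
  define z where "z m = (if even m then y m else x m)" for m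
  have init: "z (-1) = x (-1)" "z 0 = y 0"
    by (simp_all add: z_def)
  have "z (m + 1) = 1 / (z m * (z (m - 1) + 1) + 1)" if "m \<ge> 0" for m
    using that by (auto simp: z_def x_rec y_rec)
  then have "z m = trib_comb (x (-1)) (y 0) (m - 1) / trib_comb (x (-1)) (y 0) m" if "m \<ge> -1" for m
    using scalar_solution [of z m] nz that by (simp add: init)
  from this [of "2*n - 1"] this [of "2*n"] \<open>n \<ge> 0\<close>
  show "x (2*n - 1) = trib_comb (x (-1)) (y 0) (2*n - 1 - 1) / trib_comb (x (-1)) (y 0) (2*n - 1)"
    and "y (2*n) = trib_comb (x (-1)) (y 0) (2*n - 1) / trib_comb (x (-1)) (y 0) (2*n)"
    by (simp_all add: z_def)
qed

text \<open>At \<open>m = 2*n\<close> the two values are \<open>D n\<close> and \<open>B n\<close>;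
  at \<open>m = 2*n - 1\<close> they are \<open>A n\<close> and \<open>C n\<close>.\<close>

lemma trib_comb_nonzero:
  assumes "(x', y', x, y) \<notin> F" and "m \<ge> -1"
  shows "trib_comb x' y m \<noteq> 0" and "trib_comb y' x m \<noteq> 0"
proof -
  have nz: "A n x' y' x y \<noteq> 0" "B n x' y' x y \<noteq> 0" "C n x' y' x y \<noteq> 0" "D n x' y' x y \<noteq> 0"
    if "n \<ge> -1" for n
    using assms(1) that by (auto simp: F_def)
  show "trib_comb x' y m \<noteq> 0" "trib_comb y' x m \<noteq> 0"
  proof (atomize (full), cases "even m")
    case True
    then obtain n where "m = 2*n" by blast
    then show "trib_comb x' y m \<noteq> 0 \<and> trib_comb y' x m \<noteq> 0"
      using nz(2,4) [of n] \<open>m \<ge> -1\<close> by (simp add: B_def D_def trib_comb_def)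
  next
    case False
    then obtain k where "m = 2*k + 1" by (blast elim: oddE)
    then have "m = 2*(k + 1) - 1" by simp
    then obtain n where "m = 2*n - 1" by blast
    then show "trib_comb x' y m \<noteq> 0 \<and> trib_comb y' x m \<noteq> 0"
      using nz(1,3) [of n] \<open>m \<ge> -1\<close> by (simp add: A_def C_def trib_comb_def)
  qed
qed

theorem theorem5:
  fixes x y :: "int \<Rightarrow> real"
  assumes "is_solution x y"
    and "(x (-1), y (-1), x 0, y 0) \<notin> F"
  shows "\<forall>n::int. n \<ge> 0 \<longrightarrow>
      x (2*n - 1) =
        (T (2*n - 2) * x (-1) * y 0 + (T (2*n) - T (2*n - 1)) * y 0 + T (2*n - 1)) /
        (T (2*n - 1) * x (-1) * y 0 + (T (2*n - 2) + T (2*n - 1)) * y 0 + T (2*n)) \<and>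
      x (2*n) =
        (T (2*n - 1) * y (-1) * x 0 + (T (2*n + 1) - T (2*n)) * x 0 + T (2*n)) /
        (T (2*n) * y (-1) * x 0 + (T (2*n - 1) + T (2*n)) * x 0 + T (2*n + 1)) \<and>
      y (2*n - 1) =
        (T (2*n - 2) * y (-1) * x 0 + (T (2*n) - T (2*n - 1)) * x 0 + T (2*n - 1)) /
        (T (2*n - 1) * y (-1) * x 0 + (T (2*n - 2) + T (2*n - 1)) * x 0 + T (2*n)) \<and>
      y (2*n) =
        (T (2*n - 1) * x (-1) * y 0 + (T (2*n + 1) - T (2*n)) * y 0 + T (2*n)) /
        (T (2*n) * x (-1) * y 0 + (T (2*n - 1) + T (2*n)) * y 0 + T (2*n + 1))"
proof (intro allI impI)
  fix n :: int
  assume n: "n \<ge> 0"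
  have x_rec: "\<And>n. n \<ge> 0 \<Longrightarrow> x (n + 1) = 1 / (y n * (x (n - 1) + 1) + 1)"
    and y_rec: "\<And>n. n \<ge> 0 \<Longrightarrow> y (n + 1) = 1 / (x n * (y (n - 1) + 1) + 1)"
    using assms(1) by (auto simp: is_solution_def)
  note nz = trib_comb_nonzero [OF assms(2)]
  note sol = interleaved_solution [OF x_rec y_rec nz(1) n] interleaved_solution [OF y_rec x_rec nz(2) n]
  note formulas = sol [unfolded trib_comb_pred, unfolded trib_comb_def, simplified]
  show "x (2*n - 1) =
        (T (2*n - 2) * x (-1) * y 0 + (T (2*n) - T (2*n - 1)) * y 0 + T (2*n - 1)) /
        (T (2*n - 1) * x (-1) * y 0 + (T (2*n - 2) + T (2*n - 1)) * y 0 + T (2*n)) \<and>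
      x (2*n) =
        (T (2*n - 1) * y (-1) * x 0 + (T (2*n + 1) - T (2*n)) * x 0 + T (2*n)) /
        (T (2*n) * y (-1) * x 0 + (T (2*n - 1) + T (2*n)) * x 0 + T (2*n + 1)) \<and>
      y (2*n - 1) =
        (T (2*n - 2) * y (-1) * x 0 + (T (2*n) - T (2*n - 1)) * x 0 + T (2*n - 1)) /
        (T (2*n - 1) * y (-1) * x 0 + (T (2*n - 2) + T (2*n - 1)) * x 0 + T (2*n)) \<and>
      y (2*n) =
        (T (2*n - 1) * x (-1) * y 0 + (T (2*n + 1) - T (2*n)) * y 0 + T (2*n)) /
        (T (2*n) * x (-1) * y 0 + (T (2*n - 1) + T (2*n)) * y 0 + T (2*n + 1))"
    \<comment> \<open>Unfolding \<open>trib_comb_pred\<close> also hits the denominators at index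
      \<open>2*n - 1\<close>, leaving \<open>T (2*n + 1) - T (2*n)\<close> where the goal has
      \<open>T (2*n - 2) + T (2*n - 1)\<close>; the recurrence identifies the two.\<close>
    using formulas T_recurrence [of "2*n"] by simp
qed

end
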